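(* Let $\mathbb{F}_q$ be a finite field, let $k \ge 1$, and let $L(x_1, \dots, x_k) = a_1 x_1 + \cdots + a_k x_k$ be a linear form with $a_1, \dots, a_k \in \mathbb{F}_q \setminus\{0\}$. Let $\ell \ge 0$ and let $L'$ be the linear form in $k+\ell$ variables obtained by adding $\ell$ free variables to $L$, i.e. $L'(x_1, \dots, x_{k+\ell}) = a_1 x_1 + \cdots + a_k x_k + 0 x_{k+1} + \cdots + 0 x_{k+\ell}$. Then $L'$ is never inhomogeneous-Sidorenko, and $L'$ is inhomogeneous-common if and only if $k$ is odd and $\ell = 0$.
   Context: Here $q$ is a prime power and $\mathbb{F}_q$ is the finite field with $q$ elements. A linear form $M(x_1,\dots,x_m) = c_1x_1+\cdots+c_mx_m$ with $c_1,\dots,c_m \in \mathbb{F}_q$ (coefficients may be zero) is evaluated on tuples $(x_1,\dots,x_m) \in (\mathbb{F}_q^n)^m$ of vectors, for any positive integer $n$. Solutions are ordered tuples, and coordinates may coincide. The linear form $M$ in $m$ variables is *inhomogeneous-Sidorenko* if for every $n$, every nonzero $b \in \mathbb{F}_q^n$, and every $A \subseteq \mathbb{F}_q^n$, the number of solutions to $M(x_1,\dots,x_m)=b$ with $x_1,\dots,x_m \in A$ is at least $|A|^m/q^n$. The linear form $M$ in $m$ variables is *inhomogeneous-common* if for every $n$, every nonzero $b \in \mathbb{F}_q^n$, and every coloring of $\mathbb{F}_q^n$ with two colors, the number of monochromatic solutions $(x_1,\dots,x_m) \in (\mathbb{F}_q^n)^m$ to $M(x_1,\dots,x_m)=b$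 (i.e. solutions with all of $x_1,\dots,x_m$ of the same color, including variables with zero coefficient) is at least $2^{1-m} q^{n(m-1)}$. *)

theory Defs
  imports Complex_Main "HOL-Library.Cardinality" "Jordan_Normal_Form.Matrix"
begin

text \<open>
  The field with \<open>q\<close> elements is a type of class \<open>{field, finite}\<close> with \<open>q = CARD('a)\<close>, and
  the space of vectors of length \<open>n\<close> over it is \<open>carrier_vec n\<close>. A linear form in \<open>m\<close> variables
  is its list of \<open>m\<close> coefficients (zeros allowed, and counted as variables); an ordered tuple
  of vectors is a list.
\<close>

definition form_eval :: "nat \<Rightarrow> 'a::field list \<Rightarrow> 'a vec list \<Rightarrow> 'a vec" where
  "form_eval n M xs = vec n (\<lambda>i. \<Sum>j<length M. M ! j * (xs ! j) $ i)"

definition solutions :: "nat \<Rightarrow> 'a::field list \<Rightarrow> 'a vec \<Rightarrow> 'a vec set \<Rightarrow> 'a vec list set" where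
  "solutions n M b A = {xs. length xs = length M \<and> set xs \<subseteq> A \<and> form_eval n M xs = b}"

definition inhomogeneous_Sidorenko :: "'a::{field,finite} list \<Rightarrow> bool" where
  "inhomogeneous_Sidorenko M \<longleftrightarrow>
     (\<forall>n>0. \<forall>b \<in> carrier_vec n - {0\<^sub>v n}. \<forall>A \<subseteq> carrier_vec n.
        real (card (solutions n M b A)) \<ge> real (card A) ^ length M / real CARD('a) ^ n)"

definition monochromatic :: "('b \<Rightarrow> bool) \<Rightarrow> 'b list \<Rightarrow> bool" where
  "monochromatic color xs \<longleftrightarrow> (\<exists>c. \<forall>x \<in> set xs. color x = c)"

definition inhomogeneous_common :: "'a::{field,finite} list \<Rightarrow> bool" where
  "inhomogeneous_common M \<longleftrightarrow>
     (\<forall>n>0. \<forall>b \<in> carrier_vec n - {0\<^sub>v n}. \<forall>color :: 'a vec \<Rightarrow> bool.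
        real (card {xs \<in> solutions n M b (carrier_vec n). monochromatic color xs})
          \<ge> 2 powi (1 - int (length M)) * real CARD('a) powi (int n * (int (length M) - 1)))"

definition add_free_variables :: "nat \<Rightarrow> 'a::field list \<Rightarrow> 'a list" where
  "add_free_variables l L = L @ replicate l 0"

end

theory Submission
  imports Defs "HOL-Analysis.Convex" "Berlekamp_Zassenhaus.Berlekamp_Type_Based"
begin

text \<open>
  Write \<open>q\<close> for the field size, \<open>Q = q^n\<close>, \<open>\<alpha> = |A|\<close>, \<open>\<beta> = |B|\<close> with \<open>B\<close> the complement of \<open>A\<close>,
  and \<open>m = k + \<ell>\<close> for the number of variables.

  Every linear form fails the Sidorenko property because of \<open>A = {0}\<close>, which contains no solution
  for \<open>b \<noteq> 0\<close>.

  For \<open>k\<close> odd and \<open>\<ell> = 0\<close> the number of monochromatic solutions depends only on the sizes of the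
  colour classes. Moving one variable after another from \<open>A\<close> to \<open>B\<close> gives (lemma
  \<open>solutions_complement\<close>)
  \<open>N(A) - (-1)^k N(B) = (\<alpha>^k - (-\<beta>)^k) / Q\<close>, which for odd \<open>k\<close> is
  \<open>N(A) + N(B) = (\<alpha>^k + \<beta>^k) / Q\<close>, and convexity of \<open>x^k\<close> gives the required bound.

  In all other cases a colouring can be bad merely because of the number of vectors in \<open>A\<close> for each
  value of the first coordinate. Let \<open>A\<close> contain \<open>w\<close> vectors with first coordinate \<open>0\<close> and \<open>c\<close> vectors
  with first coordinate \<open>t\<close>, for each \<open>t \<noteq> 0\<close>. The distribution of the first coordinate is then
  uniform up to a point mass \<open>w - c\<close> at \<open>0\<close>; for a sum of \<open>k\<close> nonzero multiples the point mass is
  \<open>(w - c)^k\<close>, still at \<open>0\<close>. It is missing at the value \<open>1\<close>, so the average of \<open>N(A)\<close> over all \<open>b\<close> with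
  first coordinate \<open>1\<close> is \<open>(\<alpha>^m - (w - c)^k \<alpha>^\<ell>) / Q\<close> (lemma \<open>slice_count_two_level\<close>). For \<open>B\<close> the
  point mass changes sign. Hence for some such \<open>b\<close> the number of monochromatic solutions is at most
  \<open>(\<alpha>^m + \<beta>^m - (w - c)^k (\<alpha>^\<ell> + (-1)^k \<beta>^\<ell>)) / Q\<close>
  (lemma \<open>common_two_level_bound\<close> is this in contrapositive form).

  Take \<open>w\<close> as large as possible and choose \<open>c\<close> so that \<open>\<alpha> = (1 + y) Q / 2\<close> with small \<open>y > 0\<close>.
  After division by \<open>(Q/2)^m\<close>, the deviation of \<open>\<alpha>^m + \<beta>^m\<close> from its minimum is of second order
  in \<open>y\<close>. Since \<open>w - c\<close> is at least a constant multiple of \<open>Q\<close>, the subtracted term is at least a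
  constant multiple of \<open>y\<close>: \<open>\<alpha>^\<ell> + (-1)^k \<beta>^\<ell>\<close> is large if \<open>k\<close> is even, and has a first-order term if
  \<open>k\<close> is odd and \<open>\<ell> > 0\<close>. So for small \<open>y\<close> (that is, large \<open>n\<close>) the count is below the random one.
\<close>

section \<open>Counting solutions one variable at a time\<close>

lemma form_eval_Cons:
  assumes "x \<in> carrier_vec n"
  shows "form_eval n (a # M) (x # xs) = a \<cdot>\<^sub>v x + form_eval n M xs"
  using assms by (intro eq_vecI) (auto simp: form_eval_def sum.lessThan_Suc_shift simp del: sum.lessThan_Suc)

lemma form_eval_carrier [simp]: "form_eval n M xs \<in> carrier_vec n"
  by (simp add: form_eval_def)

lemma card_complement:
  fixes A :: "'a::finite vec set"
  assumes "A \<subseteq> carrier_vec n"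
  shows "real (card A) + real (card (carrier_vec n - A)) = real CARD('a) ^ n"
proof -
  have "card A + card (carrier_vec n - A) = CARD('a) ^ n"
    using assms
    by (metis card_Diff_subset card_carrier_vec card_mono finite_carrier_vec finite_subset
        le_add_diff_inverse)
  then show ?thesis by (metis of_nat_add of_nat_power)
qed

lemma finite_solutions:
  fixes M :: "'a::{field,finite} list"
  assumes "A \<subseteq> carrier_vec n"
  shows "finite (solutions n M b A)"
proof (rule finite_subset)
  show "solutions n M b A \<subseteq> {xs. set xs \<subseteq> A \<and> length xs = length M}"
    by (auto simp: solutions_def)
  show "finite {xs. set xs \<subseteq> A \<and> length xs = length M}"
    by (rule finite_lists_length_eq) (rule finite_subset[OF assms finite_carrier_vec])
qed

lemma add_vec_eq_iff_eq_minus: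
  fixes b :: "'a::ab_group_add vec"
  assumes "u \<in> carrier_vec n" "v \<in> carrier_vec n" "b \<in> carrier_vec n"
  shows "u + v = b \<longleftrightarrow> v = b - u"
  using assms by (auto simp: vec_eq_iff algebra_simps)

text \<open>
  Fixing the first variable moves its term to the right-hand side. This recursion drives every
  induction on the coefficient list below.
\<close>

lemma card_solutions_Cons:
  fixes M :: "'a::{field,finite} list"
  assumes A: "A \<subseteq> carrier_vec n" and b: "b \<in> carrier_vec n"
  shows "card (solutions n (a # M) b A) = (\<Sum>x\<in>A. card (solutions n M (b - a \<cdot>\<^sub>v x) A))"
proof -
  have "solutions n (a # M) b A =
          (\<lambda>(x, xs). x # xs) ` Sigma A (\<lambda>x. solutions n M (b - a \<cdot>\<^sub>v x) A)" (is "?S = ?T")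
  proof (intro equalityI subsetI)
    fix ys assume "ys \<in> ?S"
    then obtain x xs where ys: "ys = x # xs" and *: "x \<in> A" "length xs = length M" "set xs \<subseteq> A"
        "form_eval n (a # M) (x # xs) = b"
      by (cases ys) (auto simp: solutions_def)
    moreover have "form_eval n M xs = b - a \<cdot>\<^sub>v x"
      using * A b by (subst add_vec_eq_iff_eq_minus[symmetric]) (auto simp: form_eval_Cons subset_iff)
    ultimately show "ys \<in> ?T" by (auto simp: solutions_def image_iff)
  next
    fix ys assume "ys \<in> ?T"
    then obtain x xs where ys: "ys = x # xs" and *: "x \<in> A" "length xs = length M" "set xs \<subseteq> A"
        "form_eval n M xs = b - a \<cdot>\<^sub>v x"
      by (auto simp: solutions_def)
    moreover from this have "form_eval n (a # M) (x # xs) = b"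
      using A b by (subst form_eval_Cons, blast) (subst add_vec_eq_iff_eq_minus, auto)
    ultimately show "ys \<in> ?S" by (auto simp: solutions_def)
  qed
  moreover have "inj_on (\<lambda>(x, xs). x # xs) (Sigma A (\<lambda>x. solutions n M (b - a \<cdot>\<^sub>v x) A))"
    by (auto simp: inj_on_def)
  moreover have "finite A" using A finite_carrier_vec finite_subset by blast
  ultimately show ?thesis
    using finite_solutions[OF A] by (simp add: card_image)
qed

lemma solutions_Nil:
  "solutions n [] b A = (if b = 0\<^sub>v n then {[]} else {})"
  by (auto simp: solutions_def form_eval_def zero_vec_def)

section \<open>Averaging over right-hand sides with a given first coordinate\<close>

definition slice :: "nat \<Rightarrow> 'a \<Rightarrow> 'a vec set" where
  "slice n t = {v \<in> carrier_vec n. v $ 0 = t}"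

lemma slice_subset: "slice n t \<subseteq> carrier_vec n"
  by (auto simp: slice_def)

lemma finite_slice: "finite (slice n t :: 'a::finite vec set)"
  by (rule finite_subset[OF slice_subset finite_carrier_vec])

lemma card_slice: "card (slice (Suc n) t :: 'a::finite vec set) = CARD('a) ^ n"
proof -
  have "slice (Suc n) t = vCons t ` carrier_vec n"
  proof (intro equalityI subsetI)
    fix v assume "v \<in> slice (Suc n) t"
    then show "v \<in> vCons t ` carrier_vec n" by (cases v) (auto simp: slice_def)
  qed (auto simp: slice_def)
  then show ?thesis by (simp add: card_image inj_on_def card_carrier_vec)
qed

definition slice_count :: "nat \<Rightarrow> 'a::{field,finite} list \<Rightarrow> 'a \<Rightarrow> 'a vec set \<Rightarrow> real" where
  "slice_count n M t A = (\<Sum>b\<in>slice n t. real (card (solutions n M b A)))"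

lemma slice_count_Nil:
  assumes "n > 0"
  shows "slice_count n ([] :: 'a::{field,finite} list) t A = of_bool (t = 0)"
proof -
  have "slice_count n [] t A = (\<Sum>b\<in>slice n t. if b = 0\<^sub>v n then 1 else 0)"
    unfolding slice_count_def by (intro sum.cong) (auto simp: solutions_Nil)
  also have "\<dots> = of_bool (0\<^sub>v n \<in> slice n t)"
    by (simp add: finite_slice)
  also have "0\<^sub>v n \<in> slice n t \<longleftrightarrow> t = 0"
    using assms by (auto simp: slice_def)
  finally show ?thesis .
qed

lemma slice_count_Cons:
  assumes A: "A \<subseteq> carrier_vec n" and n: "n > 0"
  shows "slice_count n (a # M) t A = (\<Sum>x\<in>A. slice_count n M (t - a * x $ 0) A)"
proof -
  have "slice_count n (a # M) t A
      = (\<Sum>b\<in>slice n t. \<Sum>x\<in>A. real (card (solutions n M (b - a \<cdot>\<^sub>v x) A)))"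
    unfolding slice_count_def
    by (intro sum.cong) (auto simp: card_solutions_Cons[OF A] slice_def)
  also have "\<dots> = (\<Sum>x\<in>A. \<Sum>b\<in>slice n t. real (card (solutions n M (b - a \<cdot>\<^sub>v x) A)))"
    by (rule sum.swap)
  also have "\<dots> = (\<Sum>x\<in>A. slice_count n M (t - a * x $ 0) A)"
    unfolding slice_count_def
  proof (rule sum.cong[OF refl])
    fix x assume "x \<in> A"
    then have x: "x \<in> carrier_vec n" using A by blast
    show "(\<Sum>b\<in>slice n t. real (card (solutions n M (b - a \<cdot>\<^sub>v x) A)))
        = (\<Sum>b\<in>slice n (t - a * x $ 0). real (card (solutions n M b A)))"
      by (rule sum.reindex_bij_witness[of _ "\<lambda>b. b + a \<cdot>\<^sub>v x" "\<lambda>b. b - a \<cdot>\<^sub>v x"])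
         (use x n in \<open>auto simp: slice_def vec_eq_iff\<close>)
  qed
  finally show ?thesis .
qed

lemma card_two_level:
  fixes A :: "'a::{field,finite} vec set" and w c :: real
  assumes A: "A \<subseteq> carrier_vec n"
    and fibre: "\<And>t. real (card (A \<inter> slice n t)) = (if t = 0 then w else c)"
  shows "real (card A) = (w - c) + real CARD('a) * c"
proof -
  have finA: "finite A" using A finite_carrier_vec finite_subset by blast
  have "A = (\<Union>t. A \<inter> slice n t)" using A by (auto simp: slice_def)
  then have "card A = (\<Sum>t\<in>UNIV. card (A \<inter> slice n t))"
    by (subst card_UN_disjoint[symmetric]) (auto simp: finA slice_def)
  then have "real (card A) = (\<Sum>t\<in>UNIV. real (card (A \<inter> slice n t)))"
    by (metis of_nat_sum)
  also have "\<dots> = (\<Sum>t\<in>UNIV. c + (if t = (0::'a) then w - c else 0))"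
    by (rule sum.cong) (simp_all add: fibre)
  also have "\<dots> = (w - c) + real CARD('a) * c"
    unfolding sum.distrib by simp
  finally show ?thesis .
qed

text \<open>
  The step is a convolution on the field: a distribution that is constant except at \<open>0\<close> stays of this
  shape when it is scaled by \<open>a \<noteq> 0\<close> and convolved with another one, and the excesses at \<open>0\<close>
  multiply. With \<open>D = (w - c)^k * |A|^l\<close> the excess of the sum at \<open>0\<close>, each value is taken
  \<open>(|A|^(k + l) - D) / q\<close> times, and \<open>0\<close> is taken \<open>D\<close> times more.
\<close>

lemma slice_count_two_level:
  fixes L :: "'a::{field,finite} list" and w c :: real
  assumes A: "A \<subseteq> carrier_vec n" and n: "n > 0" and L: "0 \<notin> set L"
    and fibre: "\<And>t. real (card (A \<inter> slice n t)) = (if t = 0 then w else c)"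
  shows "real CARD('a) * slice_count n (L @ replicate l 0) t A
    = real (card A) ^ (length L + l)
      + (real CARD('a) * of_bool (t = 0) - 1) * (w - c) ^ length L * real (card A) ^ l"
  using L
proof (induction L arbitrary: t)
  case Nil
  have "slice_count n (replicate l 0) t A = of_bool (t = 0) * real (card A) ^ l"
    by (induction l) (simp_all add: slice_count_Nil[OF n] slice_count_Cons[OF A n])
  then show ?case by (simp add: algebra_simps)
next
  case (Cons a L)
  let ?q = "real CARD('a)" and ?\<alpha> = "real (card A)" and ?D = "(w - c) ^ length L * real (card A) ^ l"
  have finA: "finite A" using A finite_carrier_vec finite_subset by blast
  have a: "a \<noteq> 0" using Cons.prems by auto
  have alpha: "?\<alpha> = (w - c) + ?q * c" by (rule card_two_level[OF A fibre])
  have hit: "(\<Sum>x\<in>A. of_bool (t - a * x $ 0 = 0)) = c + (w - c) * of_bool (t = 0)"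
  proof -
    have "{x \<in> A. t - a * x $ 0 = 0} = A \<inter> slice n (t / a)"
      using a A by (auto simp: slice_def field_simps)
    then have "(\<Sum>x\<in>A. of_bool (t - a * x $ 0 = 0)) = real (card (A \<inter> slice n (t / a)))"
      using finA by (simp add: sum_of_bool_eq Int_def)
    then show ?thesis using a by (simp add: fibre)
  qed
  have "?q * slice_count n ((a # L) @ replicate l 0) t A
      = (\<Sum>x\<in>A. ?q * slice_count n (L @ replicate l 0) (t - a * x $ 0) A)"
    by (simp add: slice_count_Cons[OF A n] sum_distrib_left)
  also have "\<dots> = (\<Sum>x\<in>A. ?\<alpha> ^ (length L + l) - ?D + ?q * ?D * of_bool (t - a * x $ 0 = 0))"
  proof (rule sum.cong[OF refl])
    fix x
    have "0 \<notin> set L" using Cons.prems by auto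
    from Cons.IH[OF this, of "t - a * x $ 0"]
    show "?q * slice_count n (L @ replicate l 0) (t - a * x $ 0) A =
      ?\<alpha> ^ (length L + l) - ?D + ?q * ?D * of_bool (t - a * x $ 0 = 0)"
      by (simp add: algebra_simps)
  qed
  also have "\<dots> = ?\<alpha> * (?\<alpha> ^ (length L + l) - ?D) + ?q * ?D * (c + (w - c) * of_bool (t = 0))"
    unfolding sum.distrib sum_distrib_left[symmetric] hit by simp
  also have "\<dots> = ?\<alpha> ^ (length (a # L) + l) + ?D * (?q * (c + (w - c) * of_bool (t = 0)) - ?\<alpha>)"
    by (simp add: algebra_simps)
  also have "?q * (c + (w - c) * of_bool (t = 0)) - ?\<alpha> = (?q * of_bool (t = 0) - 1) * (w - c)"
    by (simp add: alpha algebra_simps)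
  finally show ?case by (simp add: algebra_simps)
qed

section \<open>Exchanging a set with its complement\<close>

lemma sum_solutions_carrier:
  fixes M :: "'a::{field,finite} list"
  assumes A: "A \<subseteq> carrier_vec n"
  shows "(\<Sum>b\<in>carrier_vec n. real (card (solutions n M b A))) = real (card A) ^ length M"
proof (induction M)
  case Nil
  have "(\<Sum>b\<in>carrier_vec n. real (card (solutions n ([]::'a list) b A)))
      = (\<Sum>b\<in>carrier_vec n. if b = (0\<^sub>v n :: 'a vec) then 1 else 0)"
    by (intro sum.cong) (auto simp: solutions_Nil)
  then show ?case by simp
next
  case (Cons a M)
  have "(\<Sum>b\<in>carrier_vec n. real (card (solutions n (a # M) b A)))
      = (\<Sum>b\<in>carrier_vec n. \<Sum>x\<in>A. real (card (solutions n M (b - a \<cdot>\<^sub>v x) A)))"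
    by (intro sum.cong) (auto simp: card_solutions_Cons[OF A])
  also have "\<dots> = (\<Sum>x\<in>A. \<Sum>b\<in>carrier_vec n. real (card (solutions n M (b - a \<cdot>\<^sub>v x) A)))"
    by (rule sum.swap)
  also have "\<dots> = (\<Sum>x\<in>A. \<Sum>b\<in>carrier_vec n. real (card (solutions n M b A)))"
  proof (rule sum.cong[OF refl])
    fix x assume "x \<in> A"
    then have x: "x \<in> carrier_vec n" using A by blast
    show "(\<Sum>b\<in>carrier_vec n. real (card (solutions n M (b - a \<cdot>\<^sub>v x) A)))
        = (\<Sum>b\<in>carrier_vec n. real (card (solutions n M b A)))"
      by (rule sum.reindex_bij_witness[of _ "\<lambda>b. b + a \<cdot>\<^sub>v x" "\<lambda>b. b - a \<cdot>\<^sub>v x"])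
         (use x in \<open>auto simp: vec_eq_iff\<close>)
  qed
  also have "\<dots> = real (card A) ^ length (a # M)" by (simp add: Cons.IH)
  finally show ?case .
qed

text \<open>
  In the induction step the induction hypothesis replaces \<open>A\<close> by \<open>B\<close> in all variables except the first,
  up to sign and up to a term that depends only on the sizes of the sets.
  The two counts that then remain have every later variable in \<open>B\<close>, and a first variable in \<open>A\<close> or in
  \<open>B\<close>, thus in the whole space. A nonzero coefficient makes that first variable a function of the
  others, so together they count all tuples over \<open>B\<close>.
\<close>

lemma solutions_complement:
  fixes L :: "'a::{field,finite} list"
  assumes A: "A \<subseteq> carrier_vec n" and b: "b \<in> carrier_vec n" and L: "0 \<notin> set L"
  defines "B \<equiv> carrier_vec n - A"
  shows "real CARD('a) ^ n * (real (card (solutions n L b A))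
            - (- 1) ^ length L * real (card (solutions n L b B)))
    = real (card A) ^ length L - (- real (card B)) ^ length L"
  using b L
proof (induction L arbitrary: b)
  case Nil
  then show ?case by (simp add: solutions_Nil)
next
  case (Cons a L)
  let ?Q = "real CARD('a) ^ n" and ?\<alpha> = "real (card A)" and ?\<beta> = "real (card B)"
    and ?s = "(- 1) ^ length L :: real"
  let ?NA = "\<lambda>x. real (card (solutions n L (b - a \<cdot>\<^sub>v x) A))"
  let ?NB = "\<lambda>x. real (card (solutions n L (b - a \<cdot>\<^sub>v x) B))"
  have B: "B \<subseteq> carrier_vec n" by (auto simp: B_def)
  have a: "a \<noteq> 0" and b: "b \<in> carrier_vec n" using Cons.prems by auto
  have IH: "?Q * ?NA x = ?Q * ?s * ?NB x + (?\<alpha> ^ length L - (- ?\<beta>) ^ length L)"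
    if "x \<in> A" for x
  proof -
    have "b - a \<cdot>\<^sub>v x \<in> carrier_vec n" "0 \<notin> set L" using that A b Cons.prems by auto
    from Cons.IH[OF this] show ?thesis by (simp add: algebra_simps)
  qed
  have all: "(\<Sum>x\<in>A. ?NB x) + (\<Sum>x\<in>B. ?NB x) = ?\<beta> ^ length L"
  proof -
    have "(\<Sum>x\<in>A. ?NB x) + (\<Sum>x\<in>B. ?NB x) = (\<Sum>x\<in>carrier_vec n. ?NB x)"
      unfolding B_def using A finite_carrier_vec by (subst sum.subset_diff[of A]) auto
    also have "\<dots> = (\<Sum>y\<in>carrier_vec n. real (card (solutions n L y B)))"
      by (rule sum.reindex_bij_witness[of _ "\<lambda>y. inverse a \<cdot>\<^sub>v (b - y)" "\<lambda>x. b - a \<cdot>\<^sub>v x"])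
         (use a b in \<open>auto simp: vec_eq_iff field_simps\<close>)
    finally show ?thesis by (simp add: sum_solutions_carrier[OF B])
  qed
  have card: "?\<alpha> + ?\<beta> = ?Q"
    unfolding B_def by (rule card_complement[OF A])
  have "?Q * (real (card (solutions n (a # L) b A)) - (- 1) ^ length (a # L) * real (card (solutions n (a # L) b B)))
    = (\<Sum>x\<in>A. ?Q * ?NA x) + ?Q * ?s * (\<Sum>x\<in>B. ?NB x)"
    unfolding card_solutions_Cons[OF A b] card_solutions_Cons[OF B b] sum_distrib_left[symmetric]
    by (simp add: distrib_left right_diff_distrib)
  also have "(\<Sum>x\<in>A. ?Q * ?NA x)
      = ?Q * ?s * (\<Sum>x\<in>A. ?NB x) + ?\<alpha> * (?\<alpha> ^ length L - (- ?\<beta>) ^ length L)"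
    by (simp add: IH sum.distrib sum_distrib_left)
  also have "\<dots> + ?Q * ?s * (\<Sum>x\<in>B. ?NB x)
      = ?Q * ?s * ((\<Sum>x\<in>A. ?NB x) + (\<Sum>x\<in>B. ?NB x)) + ?\<alpha> * (?\<alpha> ^ length L - (- ?\<beta>) ^ length L)"
    by (simp add: algebra_simps)
  also have "\<dots> = (?\<alpha> + ?\<beta>) * (- ?\<beta>) ^ length L + ?\<alpha> * (?\<alpha> ^ length L - (- ?\<beta>) ^ length L)"
    by (simp add: all card power_minus[of ?\<beta>])
  also have "\<dots> = ?\<alpha> ^ length (a # L) - (- ?\<beta>) ^ length (a # L)"
    by (simp add: algebra_simps)
  finally show ?case .
qed

section \<open>The number of monochromatic solutions\<close>

lemma card_monochromatic_solutions:
  fixes M :: "'a::{field,finite} list" and color :: "'a vec \<Rightarrow> bool" and n :: nat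
  assumes "M \<noteq> []"
  defines "A \<equiv> {x \<in> carrier_vec n. color x}"
  shows "card {xs \<in> solutions n M b (carrier_vec n). monochromatic color xs}
    = card (solutions n M b A) + card (solutions n M b (carrier_vec n - A))"
proof -
  have "{xs \<in> solutions n M b (carrier_vec n). monochromatic color xs}
    = solutions n M b A \<union> solutions n M b (carrier_vec n - A)"
    (is "?l = ?r")
  proof (intro equalityI subsetI)
    fix xs assume "xs \<in> ?l"
    then obtain c where c: "\<forall>x\<in>set xs. color x = c" and "xs \<in> solutions n M b (carrier_vec n)"
      by (auto simp: monochromatic_def)
    then show "xs \<in> ?r" by (cases c) (auto simp: solutions_def A_def)
  next
    fix xs assume "xs \<in> ?r"
    then consider "xs \<in> solutions n M b A" | "xs \<in> solutions n M b (carrier_vec n - A)" by auto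
    then show "xs \<in> ?l"
      unfolding monochromatic_def
    proof cases
      case 1
      then have "\<forall>x\<in>set xs. color x = True" by (auto simp: solutions_def A_def)
      with 1 show "xs \<in> {xs \<in> solutions n M b (carrier_vec n). \<exists>c. \<forall>x\<in>set xs. color x = c}"
        by (force simp: solutions_def A_def)
    next
      case 2
      then have "\<forall>x\<in>set xs. color x = False" by (auto simp: solutions_def A_def)
      with 2 show "xs \<in> {xs \<in> solutions n M b (carrier_vec n). \<exists>c. \<forall>x\<in>set xs. color x = c}"
        by (force simp: solutions_def A_def)
    qed
  qed
  moreover have "solutions n M b A \<inter> solutions n M b (carrier_vec n - A) = {}"
  proof (rule ccontr)
    assume "\<not> ?thesis"
    then obtain xs where "length xs = length M" "set xs \<subseteq> A" "set xs \<subseteq> carrier_vec n - A"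
      by (auto simp: solutions_def)
    with assms(1) show False by (cases xs) auto
  qed
  ultimately show ?thesis
    by (simp add: card_Un_disjoint finite_solutions A_def)
qed

section \<open>Estimates near balanced colourings\<close>

text \<open>The left-hand side has a critical point at \<open>y = 0\<close>, so its growth there is less than linear.\<close>

lemma sum_powers_near_one:
  fixes \<kappa> :: real
  assumes "\<kappa> > 0"
  obtains \<eta> where "\<eta> > 0" "\<And>y. 0 < y \<Longrightarrow> y < \<eta> \<Longrightarrow> (1 + y) ^ m + (1 - y) ^ m - 2 < \<kappa> * y"
proof -
  have "((\<lambda>y::real. (1 + y) ^ m + (1 - y) ^ m) has_real_derivative 0) (at 0)"
    by (auto intro!: derivative_eq_intros)
  then have "(\<lambda>y::real. ((1 + y) ^ m + (1 - y) ^ m - 2) / y) \<midarrow>0\<rightarrow> 0"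
    by (simp add: DERIV_def)
  from LIM_D[OF this assms] obtain \<eta> where "\<eta> > 0"
    and *: "\<And>y. y \<noteq> 0 \<Longrightarrow> \<bar>y\<bar> < \<eta> \<Longrightarrow> \<bar>((1 + y) ^ m + (1 - y) ^ m - 2) / y\<bar> < \<kappa>"
    by auto
  show thesis
  proof (rule that[OF \<open>\<eta> > 0\<close>])
    fix y :: real assume "0 < y" "y < \<eta>"
    then have "\<bar>((1 + y) ^ m + (1 - y) ^ m - 2) / y\<bar> < \<kappa>" by (intro *) auto
    then have "((1 + y) ^ m + (1 - y) ^ m - 2) / y < \<kappa>" by (rule le_less_trans[OF abs_ge_self])
    with \<open>0 < y\<close> show "(1 + y) ^ m + (1 - y) ^ m - 2 < \<kappa> * y" by (simp add: field_simps)
  qed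
qed

text \<open>
  This is where the parity of \<open>k\<close> and the presence of a free variable matter: for odd \<open>k\<close> and \<open>l = 0\<close>
  the right-hand side is \<open>0\<close>.
\<close>

lemma signed_power_gain:
  fixes y :: real
  assumes y: "0 < y" "y \<le> 1" and kl: "even k \<or> l > 0"
  shows "y \<le> (1 + y) ^ l + (- 1) ^ k * (1 - y) ^ l"
proof (cases "even k")
  case True
  have "1 \<le> (1 + y) ^ l" using y by (intro one_le_power) auto
  moreover have "0 \<le> (1 - y) ^ l" using y by auto
  ultimately have "y \<le> (1 + y) ^ l + (1 - y) ^ l" using y by linarith
  then show ?thesis using True by simp
next
  case False
  then obtain j where l: "l = Suc j" using kl by (cases l) auto
  have "1 + y \<le> (1 + y) ^ l"
    using power_increasing[of 1 l "1 + y"] l y by simp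
  moreover have "(1 - y) ^ l \<le> 1" using y by (intro power_le_one) auto
  ultimately show ?thesis using False by simp
qed

lemma commonness_threshold:
  assumes "q > (0::nat)" "m > 0"
  shows "real q ^ n * (2 powi (1 - int m) * real q powi (int n * (int m - 1)))
    = 2 * (real q ^ n / 2) ^ m"
proof -
  have "real q powi (int n * (int m - 1)) = (real q ^ n) powi (int (m - 1))"
    using assms by (simp add: power_int_mult of_nat_diff)
  also have "\<dots> = (real q ^ n) ^ (m - 1)" by simp
  finally have "real q ^ n * real q powi (int n * (int m - 1)) = (real q ^ n) ^ m"
    using assms by (cases m) auto
  moreover have "(2::real) powi (1 - int m) = 2 / 2 ^ m"
    by (simp add: power_int_diff)
  ultimately show ?thesis by (simp add: power_divide mult_ac)
qed

lemma two_le_card_field: "2 \<le> CARD('a::{field,finite})"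
proof -
  have "card {0, 1 :: 'a} \<le> CARD('a)" by (rule card_mono) auto
  then show ?thesis by simp
qed

section \<open>Colourings with too few monochromatic solutions\<close>

lemma exists_two_level_set:
  fixes c w :: nat
  assumes "w \<le> CARD('a) ^ N" "c \<le> CARD('a) ^ N"
  obtains A :: "'a::{field,finite} vec set" where "A \<subseteq> carrier_vec (Suc N)"
    "\<And>t. card (A \<inter> slice (Suc N) t) = (if t = 0 then w else c)"
proof -
  have "\<forall>t :: 'a. \<exists>T \<subseteq> slice (Suc N) t. card T = (if t = 0 then w else c)"
    using assms by (intro allI) (metis card_slice obtain_subset_with_card_n)
  then obtain f :: "'a \<Rightarrow> 'a vec set" where f: "\<And>t. f t \<subseteq> slice (Suc N) t"
      "\<And>t. card (f t) = (if t = 0 then w else c)"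
    by metis
  have "(\<Union>t. f t) \<inter> slice (Suc N) t = f t" for t
    using f(1) by (fastforce simp: slice_def)
  with f slice_subset show thesis by (intro that[of "\<Union>t. f t"]) fastforce+
qed

text \<open>
  The commonness bound at each \<open>b\<close> with first coordinate \<open>1\<close> also holds on average over these \<open>b\<close>. The
  averages are given by \<open>slice_count_two_level\<close> for both colours; since \<open>B\<close> has levels
  \<open>q^N - w\<close> and \<open>q^N - c\<close>, its excess at \<open>0\<close> is \<open>-(w - c)\<close>.
\<close>

lemma common_two_level_bound:
  fixes L :: "'a::{field,finite} list" and A :: "'a vec set" and w c :: nat
  assumes common: "inhomogeneous_common (add_free_variables l L)"
    and L0: "L \<noteq> []" and L: "0 \<notin> set L"
    and A: "A \<subseteq> carrier_vec (Suc N)"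
    and fibre: "\<And>t. card (A \<inter> slice (Suc N) t) = (if t = 0 then w else c)"
  defines "B \<equiv> carrier_vec (Suc N) - A" and "k \<equiv> length L"
  shows "2 * (real CARD('a) ^ Suc N / 2) ^ (k + l)
    \<le> real (card A) ^ (k + l) + real (card B) ^ (k + l)
      - (real w - real c) ^ k * (real (card A) ^ l + (- 1) ^ k * real (card B) ^ l)"
proof -
  let ?n = "Suc N" and ?q = "real CARD('a)"
  let ?R = "?q ^ N"
  define M where "M = add_free_variables l L"
  have M: "M \<noteq> []" "length M = k + l" using L0 by (auto simp: M_def add_free_variables_def k_def)
  have B: "B \<subseteq> carrier_vec ?n" by (auto simp: B_def)
  have fibreA: "real (card (A \<inter> slice ?n t)) = (if t = 0 then real w else real c)" for t
    by (simp add: fibre)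
  have fibreB: "real (card (B \<inter> slice ?n t)) = (if t = 0 then ?R - real w else ?R - real c)" for t
  proof -
    have "A \<inter> slice ?n t \<union> B \<inter> slice ?n t = slice ?n t" "A \<inter> slice ?n t \<inter> (B \<inter> slice ?n t) = {}"
      using slice_subset[of ?n t] by (auto simp: B_def)
    then have "card (A \<inter> slice ?n t) + card (B \<inter> slice ?n t) = CARD('a) ^ N"
      using finite_slice[of ?n t] card_slice[of N t]
        card_Un_disjoint[of "A \<inter> slice ?n t" "B \<inter> slice ?n t"] by simp
    from arg_cong[OF this, of real]
    have "real (card (A \<inter> slice ?n t)) + real (card (B \<inter> slice ?n t)) = ?R" by simp
    then show ?thesis unfolding fibreA by (auto split: if_splits)
  qed
  define T where "T = 2 powi (1 - int (k + l)) * ?q powi (int ?n * (int (k + l) - 1))"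
  have lower: "T \<le> real (card (solutions ?n M b A)) + real (card (solutions ?n M b B))"
    if "b \<in> slice ?n 1" for b
  proof -
    have "{x \<in> carrier_vec ?n. x \<in> A} = A" using A by auto
    moreover have "b \<in> carrier_vec ?n - {0\<^sub>v ?n}" using that by (auto simp: slice_def)
    with common have "T \<le> real (card {xs \<in> solutions ?n M b (carrier_vec ?n).
        monochromatic (\<lambda>x. x \<in> A) xs})"
      unfolding inhomogeneous_common_def M_def[symmetric] T_def M(2) by blast
    ultimately show ?thesis
      using card_monochromatic_solutions[OF M(1), of ?n b "\<lambda>x. x \<in> A"] by (simp add: B_def)
  qed
  have "?R * T = (\<Sum>b\<in>(slice ?n 1 :: 'a vec set). T)" by (simp add: card_slice)
  also have "\<dots> \<le> (\<Sum>b\<in>slice ?n 1. real (card (solutions ?n M b A)) + real (card (solutions ?n M b B)))"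
    by (rule sum_mono) (rule lower)
  also have "\<dots> = slice_count ?n M 1 A + slice_count ?n M 1 B"
    by (simp add: slice_count_def sum.distrib)
  finally have "?q * (?R * T) \<le> ?q * (slice_count ?n M 1 A + slice_count ?n M 1 B)"
    by (intro mult_left_mono) auto
  moreover have "?q * (?R * T) = 2 * (?q ^ ?n / 2) ^ (k + l)"
    using commonness_threshold[of "CARD('a)" "k + l" ?n] L0
    unfolding T_def mult.assoc[symmetric] power_Suc[symmetric] by (simp add: k_def)
  moreover have "?q * slice_count ?n M 1 A
      = real (card A) ^ (k + l) - (real w - real c) ^ k * real (card A) ^ l"
    using slice_count_two_level[OF A _ L fibreA, of l 1]
    by (simp add: M_def add_free_variables_def k_def)
  moreover have "?q * slice_count ?n M 1 B
      = real (card B) ^ (k + l) - (real w - real c) ^ k * ((- 1) ^ k * real (card B) ^ l)"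
  proof -
    have "(?R - real w) - (?R - real c) = - 1 * (real w - real c)" by simp
    then have "((?R - real w) - (?R - real c)) ^ k = (- 1) ^ k * (real w - real c) ^ k"
      by (simp only: power_mult_distrib)
    then show ?thesis
      using slice_count_two_level[OF B _ L fibreB, of l 1]
      by (simp add: M_def add_free_variables_def k_def)
  qed
  ultimately show ?thesis unfolding distrib_left by linarith
qed

text \<open>
  The set that contains the whole slice \<open>0\<close> and \<open>c\<close> elements of each other slice can, in high
  dimension, be made only slightly larger than half of the space, with \<open>c\<close> still bounded away from the slice size.
\<close>

lemma levels_near_half:
  fixes \<eta> :: real
  assumes q: "q \<ge> (2::nat)" and \<eta>: "\<eta> > 0"
  obtains N c y where "real c \<le> 3 / 4 * real q ^ N"
    "real q ^ N + (real q - 1) * real c = real q ^ Suc N / 2 * (1 + y)" "0 < y" "y < \<eta>" "y \<le> 1"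
proof -
  obtain N where N: "max 4 (2 / \<eta>) < real q ^ N"
    using real_arch_pow[of "real q" "max 4 (2 / \<eta>)"] q by auto
  define R where "R = q ^ N"
  define d where "d = 2 * (q - 1)"
  \<comment> \<open>The least \<open>c\<close> for which the set has more than \<open>q * R / 2\<close> elements.\<close>
  define c where "c = (q - 2) * R div d + 1"
  have R: "real R > 4" "2 / real R < \<eta>"
  proof -
    have "4 < real R" "2 / \<eta> < real R" using N by (auto simp: R_def)
    then show "real R > 4" "2 / real R < \<eta>" using \<eta> by (auto simp: field_simps)
  qed
  have d: "d > 0" "real d = 2 * (real q - 1)" using q by (auto simp: d_def of_nat_diff)
  have "(q - 2) * R < c * d" "c * d \<le> (q - 2) * R + d"
    using d(1) dividend_less_div_times[of d "(q - 2) * R"] div_times_less_eq_dividend[of "(q - 2) * R" d]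
    by (auto simp: c_def)
  then have "real ((q - 2) * R) < real (c * d)" "real (c * d) \<le> real ((q - 2) * R + d)"
    by linarith+
  then have c: "(real q - 2) * R < 2 * (real q - 1) * c"
      "2 * (real q - 1) * c \<le> (real q - 2) * R + 2 * (real q - 1)"
    using q by (simp_all add: of_nat_diff d(2) mult_ac)
  define y where "y = (2 * (real q - 1) * c - (real q - 2) * R) / (real q * R)"
  show thesis
  proof (rule that[of c N y])
    have "2 * (real q - 1) * c \<le> (real q - 1) * R + 2 * (real q - 1)"
      using c(2) q by (simp add: algebra_simps)
    also have "\<dots> = 2 * (real q - 1) * (R / 2 + 1)" by (simp add: algebra_simps)
    finally have "real c \<le> real R / 2 + 1"
      using q by (subst (asm) mult_le_cancel_left_pos) auto
    then show "real c \<le> 3 / 4 * real q ^ N" using R by (simp add: R_def)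
    have "real q * R * y = 2 * (real q - 1) * c - (real q - 2) * R"
      using q R by (simp add: y_def)
    then show "real q ^ N + (real q - 1) * real c = real q ^ Suc N / 2 * (1 + y)"
      by (simp add: R_def algebra_simps)
    show "0 < y" using c(1) q R by (simp add: y_def)
    have "y \<le> (2 * real q) / (real q * R)" unfolding y_def
      using c(2) by (intro divide_right_mono) auto
    also have "\<dots> = 2 / real R" using q by simp
    finally have "y \<le> 2 / real R" .
    moreover have "2 / real R \<le> 1" using R by simp
    ultimately show "y < \<eta>" "y \<le> 1" using R(2) by linarith+
  qed
qed

lemma not_inhomogeneous_common:
  fixes L :: "'a::{field,finite} list"
  assumes L0: "L \<noteq> []" and L: "0 \<notin> set L" and kl: "even (length L) \<or> l > 0"
  shows "\<not> inhomogeneous_common (add_free_variables l L)"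
proof
  assume common: "inhomogeneous_common (add_free_variables l L)"
  define k where "k = length L"
  define m where "m = k + l"
  define q where "q = CARD('a)"
  \<comment> \<open>With \<open>c\<close> at most three quarters of the slice size, the excess \<open>q^N - c\<close> is at least \<open>q^N / 4\<close>,
    which is \<open>1 / (2 * q)\<close> times half of the space.\<close>
  define \<kappa> where "\<kappa> = (1 / (2 * real q)) ^ k"
  have q: "q \<ge> 2" unfolding q_def by (rule two_le_card_field)
  have \<kappa>: "\<kappa> > 0" using q by (simp add: \<kappa>_def)
  then obtain \<eta> where "\<eta> > 0"
    and small: "\<And>y. 0 < y \<Longrightarrow> y < \<eta> \<Longrightarrow> (1 + y) ^ m + (1 - y) ^ m - 2 < \<kappa> * y"
    using sum_powers_near_one[of \<kappa> m] by blast
  then obtain N c y where c: "real c \<le> 3 / 4 * real q ^ N"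
    and half: "real q ^ N + (real q - 1) * real c = real q ^ Suc N / 2 * (1 + y)"
    and y: "0 < y" "y < \<eta>" "y \<le> 1"
    using levels_near_half[OF q] by metis
  define h where "h = real q ^ Suc N / 2"
  define D where "D = (real q ^ N - real c) ^ k"
  have h: "h > 0" using q by (simp add: h_def)
  have "0 \<le> real q ^ N" by simp
  with c have "real c \<le> real q ^ N" by linarith
  then have "c \<le> q ^ N" by (simp only: of_nat_power[symmetric] of_nat_le_iff)
  then obtain A :: "'a vec set" where A: "A \<subseteq> carrier_vec (Suc N)"
    and fibre: "\<And>t. card (A \<inter> slice (Suc N) t) = (if t = 0 then q ^ N else c)"
    using exists_two_level_set[of "q ^ N" N c] by (auto simp: q_def)
  define B where "B = carrier_vec (Suc N) - A"
  have "real (card (A \<inter> slice (Suc N) t)) = (if t = 0 then real q ^ N else real c)" for t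
    by (simp add: fibre)
  from card_two_level[OF A this] half have \<alpha>: "real (card A) = h * (1 + y)"
    by (simp add: h_def q_def algebra_simps)
  have "real (card A) + real (card B) = 2 * h"
    unfolding B_def using card_complement[OF A] by (simp add: h_def q_def)
  with \<alpha> have \<beta>: "real (card B) = h * (1 - y)" by (simp add: algebra_simps)
  define gain where "gain = (1 + y) ^ l + (- 1) ^ k * (1 - y) ^ l"
  have gain: "y \<le> gain"
    unfolding gain_def by (rule signed_power_gain) (use y kl in \<open>auto simp: k_def\<close>)
  have "2 * h ^ m \<le> (h * (1 + y)) ^ m + (h * (1 - y)) ^ m
      - D * ((h * (1 + y)) ^ l + (- 1) ^ k * (h * (1 - y)) ^ l)"
    using common_two_level_bound[OF common L0 L A fibre]
    unfolding B_def[symmetric] k_def[symmetric] q_def[symmetric] m_def[symmetric]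
      h_def[symmetric] \<alpha> \<beta> by (simp add: D_def)
  also have "\<dots> = h ^ m * ((1 + y) ^ m + (1 - y) ^ m) - D * (h ^ l * gain)"
    unfolding power_mult_distrib gain_def by (simp add: algebra_simps)
  also have "\<dots> \<le> h ^ m * ((1 + y) ^ m + (1 - y) ^ m) - h ^ m * (\<kappa> * y)"
  proof -
    have "(h / (2 * real q)) ^ k \<le> D"
      unfolding D_def using c q h by (intro power_mono) (auto simp: h_def)
    then have "h ^ k * \<kappa> \<le> D" by (simp add: \<kappa>_def power_divide)
    moreover have "h ^ l * y \<le> h ^ l * gain" using gain h by simp
    ultimately have "(h ^ k * \<kappa>) * (h ^ l * y) \<le> D * (h ^ l * gain)"
      using \<kappa> h y by (intro mult_mono) (auto intro: order_trans[rotated])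
    then show ?thesis by (simp add: m_def power_add mult_ac)
  qed
  also have "\<dots> = 2 * h ^ m + h ^ m * ((1 + y) ^ m + (1 - y) ^ m - 2 - \<kappa> * y)"
    by (simp add: algebra_simps)
  also have "\<dots> < 2 * h ^ m"
    using small[OF y(1,2)] h by (simp add: mult_less_0_iff)
  finally show False by simp
qed

section \<open>The characterisation\<close>

lemma inhomogeneous_common_odd:
  fixes L :: "'a::{field,finite} list"
  assumes L: "0 \<notin> set L" and odd: "odd (length L)"
  shows "inhomogeneous_common L"
  unfolding inhomogeneous_common_def
proof (intro allI impI ballI)
  fix n :: nat and b :: "'a vec" and color :: "'a vec \<Rightarrow> bool"
  assume b: "b \<in> carrier_vec n - {0\<^sub>v n}"
  define k where "k = length L"
  define A where "A = {x \<in> carrier_vec n. color x}"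
  define B where "B = carrier_vec n - A"
  let ?Q = "real CARD('a) ^ n" and ?\<alpha> = "real (card A)" and ?\<beta> = "real (card B)"
  let ?count = "real (card (solutions n L b A)) + real (card (solutions n L b B))"
  have A: "A \<subseteq> carrier_vec n" by (auto simp: A_def)
  have L0: "L \<noteq> []" using odd by auto
  have sum: "?\<alpha> + ?\<beta> = ?Q"
    unfolding B_def by (rule card_complement[OF A])
  have Q: "?Q > 0" by simp
  have "2 * (?Q / 2) ^ k \<le> ?\<alpha> ^ k + ?\<beta> ^ k"
  proof -
    have half: "(1 - 1 / 2) * ?\<alpha> + 1 / 2 * ?\<beta> = ?Q / 2"
      unfolding sum[symmetric] by (simp add: add_divide_distrib)
    have "convex_on {0::real..} (\<lambda>x. x ^ k)"
      using odd unfolding k_def by (rule convex_power_odd)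
    from convex_onD[OF this, of "1 / 2" ?\<alpha> ?\<beta>]
    have "((1 - 1 / 2) * ?\<alpha> + 1 / 2 * ?\<beta>) ^ k \<le> (1 - 1 / 2) * ?\<alpha> ^ k + 1 / 2 * ?\<beta> ^ k"
      by simp
    then show ?thesis unfolding half by simp
  qed
  also have "\<dots> = ?Q * ?count"
    using solutions_complement[OF A, of b L] b L odd by (simp add: B_def k_def)
  finally have "?Q * (2 powi (1 - int k) * real CARD('a) powi (int n * (int k - 1))) \<le> ?Q * ?count"
    using L0 by (subst commonness_threshold) (auto simp: k_def)
  then have "2 powi (1 - int k) * real CARD('a) powi (int n * (int k - 1)) \<le> ?count"
    using Q by (subst (asm) mult_le_cancel_left_pos) auto
  then show "2 powi (1 - int (length L)) * real CARD('a) powi (int n * (int (length L) - 1))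
    \<le> real (card {xs \<in> solutions n L b (carrier_vec n). monochromatic color xs})"
    using card_monochromatic_solutions[OF L0, of n b color] by (simp add: k_def A_def B_def)
qed

lemma not_inhomogeneous_Sidorenko:
  fixes M :: "'a::{field,finite} list"
  shows "\<not> inhomogeneous_Sidorenko M"
proof
  assume sid: "inhomogeneous_Sidorenko M"
  let ?b = "vec 1 (\<lambda>_. 1) :: 'a vec" and ?A = "{0\<^sub>v 1} :: 'a vec set"
  have b: "?b \<in> carrier_vec 1 - {0\<^sub>v 1}" by (auto simp: vec_eq_iff)
  have "solutions 1 M ?b ?A = {}"
  proof (rule ccontr)
    assume "\<not> ?thesis"
    then obtain xs where xs: "length xs = length M" "set xs \<subseteq> ?A" "form_eval 1 M xs = ?b"
      by (auto simp: solutions_def)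
    have "xs ! j = 0\<^sub>v 1" if "j < length M" for j
      using that xs(1,2) by (metis nth_mem singletonD subsetD)
    then have "form_eval 1 M xs = 0\<^sub>v 1" by (auto simp: form_eval_def)
    with xs(3) b show False by auto
  qed
  moreover have "real (card (solutions 1 M ?b ?A)) \<ge> real (card ?A) ^ length M / real CARD('a) ^ 1"
    using sid[unfolded inhomogeneous_Sidorenko_def, rule_format, of 1 ?b ?A] b by auto
  ultimately show False by simp
qed

theorem theorem1p7:
  fixes a :: "'a::{field,finite} list" and k l :: nat
  assumes "k \<ge> 1" and "length a = k" and "\<forall>i<k. a ! i \<noteq> 0"
  shows "\<not> inhomogeneous_Sidorenko (add_free_variables l a) \<and>
         (inhomogeneous_common (add_free_variables l a) \<longleftrightarrow> odd k \<and> l = 0)"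
proof -
  have a: "a \<noteq> []" "0 \<notin> set a" using assms by (auto simp: in_set_conv_nth)
  have "inhomogeneous_common (add_free_variables l a)" if "odd k" "l = 0"
    using inhomogeneous_common_odd[OF a(2)] that assms(2) by (simp add: add_free_variables_def)
  then show ?thesis
    using not_inhomogeneous_Sidorenko not_inhomogeneous_common[OF a, of l] assms(2) by blast
qed

end
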